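(* Let $p>2$ be a prime and let $G$ be a finite $p$-group of nilpotency class $n$, where $n\ge 4$. Suppose that $|\gamma_n(G)|=p$, that $\exp(\gamma_{n-1}(G))=p$, and that $Z(C_G(x))\le \gamma_{n-1}(G)$ for all $x\in \gamma_{n-1}(G)\setminus Z(G)$. Then $G$ has a non-inner automorphism of order $p$ that fixes $\Phi(G)$ element-wise.
   Context: For a group $G$, $\gamma_m(G)$ denotes the $m$th term of the lower central series of $G$ (with $\gamma_1(G)=G$ and $\gamma_{m+1}(G)=[\gamma_m(G),G]$), so nilpotency class $n$ means $\gamma_{n+1}(G)=1\ne\gamma_n(G)$. $Z(H)$ denotes the center of a group $H$, $C_G(x)$ the centralizer of $x$ in $G$, $\Phi(G)$ the Frattini subgroup of $G$, and $\exp(H)$ the exponent of a finite group $H$. An automorphism $\alpha$ of $G$ fixes $\Phi(G)$ element-wise if $\alpha(u)=u$ for every $u\in\Phi(G)$; it is non-inner if it is not conjugation by an element of $G$. *)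

theory Defs
  imports "HOL-Algebra.Algebra"
begin

definition p_group :: "nat \<Rightarrow> ('a, 'b) monoid_scheme \<Rightarrow> bool" where
  "p_group p G \<longleftrightarrow> group G \<and> (\<exists>k. order G = p ^ k)"

definition center :: "('a, 'b) monoid_scheme \<Rightarrow> 'a set" where
  "center G = {z \<in> carrier G. \<forall>g \<in> carrier G. z \<otimes>\<^bsub>G\<^esub> g = g \<otimes>\<^bsub>G\<^esub> z}"

definition centralizer :: "('a, 'b) monoid_scheme \<Rightarrow> 'a \<Rightarrow> 'a set" where
  "centralizer G x = {g \<in> carrier G. g \<otimes>\<^bsub>G\<^esub> x = x \<otimes>\<^bsub>G\<^esub> g}"

text \<open>
  The order of the factors in a commutator follows the library's \<^const>\<open>derived\<close>;
  the generated subgroup is the same for the other usual convention.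
\<close>

definition commutator_subgroup :: "('a, 'b) monoid_scheme \<Rightarrow> 'a set \<Rightarrow> 'a set \<Rightarrow> 'a set" where
  "commutator_subgroup G H K =
     generate G (\<Union>h \<in> H. \<Union>k \<in> K. {h \<otimes>\<^bsub>G\<^esub> k \<otimes>\<^bsub>G\<^esub> inv\<^bsub>G\<^esub> h \<otimes>\<^bsub>G\<^esub> inv\<^bsub>G\<^esub> k})"

text \<open>The lower central series is indexed from 1; the value at 0 is only a filler.\<close>

fun lower_central :: "('a, 'b) monoid_scheme \<Rightarrow> nat \<Rightarrow> 'a set" where
  "lower_central G 0 = carrier G"
| "lower_central G (Suc 0) = carrier G"
| "lower_central G (Suc (Suc m)) = commutator_subgroup G (lower_central G (Suc m)) (carrier G)"

text \<open>Meant for \<open>n \<ge> 1\<close>, that is, for non-trivial groups.\<close>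

definition has_nilpotency_class :: "('a, 'b) monoid_scheme \<Rightarrow> nat \<Rightarrow> bool" where
  "has_nilpotency_class G n \<longleftrightarrow>
     lower_central G (n + 1) = {\<one>\<^bsub>G\<^esub>} \<and> lower_central G n \<noteq> {\<one>\<^bsub>G\<^esub>}"

definition maximal_subgroup :: "'a set \<Rightarrow> ('a, 'b) monoid_scheme \<Rightarrow> bool" where
  "maximal_subgroup M G \<longleftrightarrow>
     subgroup M G \<and> M \<noteq> carrier G \<and>
     (\<forall>H. subgroup H G \<longrightarrow> M \<subseteq> H \<longrightarrow> H = M \<or> H = carrier G)"

text \<open>Intersecting with the carrier gives the whole group when there is no maximal subgroup.\<close>

definition frattini :: "('a, 'b) monoid_scheme \<Rightarrow> 'a set" where
  "frattini G = carrier G \<inter> \<Inter> {M. maximal_subgroup M G}"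

definition group_exponent :: "('a, 'b) monoid_scheme \<Rightarrow> nat" where
  "group_exponent G = (LEAST m. m > 0 \<and> (\<forall>x \<in> carrier G. x [^]\<^bsub>G\<^esub> m = \<one>\<^bsub>G\<^esub>))"

text \<open>
  The maps are restricted to the carrier because the elements of the library's
  \<^const>\<open>auto\<close> are extensional functions.
\<close>

definition inner_auto :: "('a, 'b) monoid_scheme \<Rightarrow> ('a \<Rightarrow> 'a) set" where
  "inner_auto G =
     (\<lambda>g. \<lambda>x \<in> carrier G. g \<otimes>\<^bsub>G\<^esub> x \<otimes>\<^bsub>G\<^esub> inv\<^bsub>G\<^esub> g) ` carrier G"

end

theory Submission
  imports Defs
begin

text \<open>
  Choose \<open>x \<in> \<gamma>\<^sub>n\<^sub>-\<^sub>1(G)\<close> outside the center. Since \<open>y \<mapsto> [x, y]\<close> is a homomorphism onto the central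
  subgroup \<open>\<gamma>\<^sub>n(G)\<close> of order \<open>p\<close>, its kernel \<open>M = C\<^sub>G(x)\<close> is a maximal subgroup, so it contains
  the Frattini subgroup. For \<open>g \<notin> M\<close> the map fixing \<open>M\<close> element-wise and sending \<open>g\<close> to \<open>g x\<close>
  (here: to \<open>g x\<close> times a central element) is an automorphism because \<open>x\<close> has order \<open>p\<close> and \<open>p\<close>
  is odd. If it were conjugation by \<open>h\<close>, then \<open>h \<in> Z(M) \<le> \<gamma>\<^sub>n\<^sub>-\<^sub>1(G)\<close>, so \<open>x\<close> would be central.
\<close>

section \<open>Powers, subgroups of prime order, centralizers and automorphism groups\<close>

lemma (in group) pow_mod_cong:
  assumes "x \<in> carrier G" and "x [^] p = \<one>" and "i mod p = j mod (p::nat)"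
  shows "x [^] i = x [^] j"
proof -
  have *: "x [^] k = x [^] (k mod p)" for k
  proof -
    have "x [^] k = x [^] (p * (k div p) + k mod p)" by simp
    also have "\<dots> = x [^] (k mod p)"
      using assms(1,2) by (simp only: nat_pow_mult [symmetric] nat_pow_pow [symmetric]) simp
    finally show ?thesis .
  qed
  show ?thesis using * assms(3) by metis
qed

text \<open>By Lagrange inside \<open>H\<close>, \<open>ord c\<close> divides \<open>p\<close>, and
  it is not 1. So the cyclic subgroup of \<open>c\<close>, which lies in \<open>H\<close>, already
  has as many elements as \<open>H\<close>.\<close>

lemma (in group) prime_card_subgroup_generator:
  assumes "subgroup H G" and "card H = p" and "Factorial_Ring.prime p"
    and "c \<in> H" and "c \<noteq> \<one>" and "finite (carrier G)"
  shows "ord c = p" and "\<And>y. y \<in> H \<Longrightarrow> \<exists>k::nat. y = c [^] k"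
proof -
  have c: "c \<in> carrier G" using assms(1,4) subgroup.mem_carrier by fastforce
  have sub: "generate G {c} \<subseteq> H"
    using assms(1,4) by (simp add: generate_subgroup_incl)
  have finH: "finite H"
    using assms(1,6) by (meson finite_subset subgroup.subset)
  interpret H: group "G\<lparr>carrier := H\<rparr>"
    using assms(1) by (rule subgroup.subgroup_is_group) (rule group_axioms)
  have "c [^]\<^bsub>G\<lparr>carrier := H\<rparr>\<^esub> order (G\<lparr>carrier := H\<rparr>) = \<one>"
    using H.pow_order_eq_1[of c] assms(4) by simp
  then have "c [^] p = \<one>"
    using assms(2) by (simp add: order_def nat_pow_def)
  then have "ord c dvd p" using c pow_eq_id by blast
  moreover have "ord c \<noteq> 1" using c assms(5) ord_eq_1 by blast
  ultimately show ord: "ord c = p" using assms(3) by (auto simp: prime_nat_iff)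
  have "generate G {c} = H"
    using sub finH assms(2) ord generate_pow_card[OF c] by (metis card_subset_eq)
  then show "\<exists>k::nat. y = c [^] k" if "y \<in> H" for y
    using that generate_pow_on_finite_carrier[OF assms(6) c] by auto
qed

lemma (in group) center_pow:
  assumes "z \<in> center G"
  shows "z [^] (k::nat) \<in> center G"
proof -
  have "z \<in> carrier G" using assms by (simp add: center_def)
  have "z [^] k \<otimes> g = g \<otimes> z [^] k" if "g \<in> carrier G" for g
    using assms that by (intro group_commutes_pow) (auto simp: center_def)
  then show ?thesis using \<open>z \<in> carrier G\<close> by (simp add: center_def)
qed

lemma (in group) inv_commutes:
  assumes "a \<in> carrier G" "b \<in> carrier G" "a \<otimes> b = b \<otimes> a"
  shows "inv a \<otimes> b = b \<otimes> inv a"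
proof -
  have "inv a \<otimes> b = inv a \<otimes> (b \<otimes> a) \<otimes> inv a" using assms(1,2) by (simp add: m_assoc)
  also have "\<dots> = inv a \<otimes> (a \<otimes> b) \<otimes> inv a" by (simp only: assms(3))
  also have "\<dots> = b \<otimes> inv a" using assms(1,2) by (simp add: m_assoc [symmetric])
  finally show ?thesis .
qed

lemma (in group) subgroup_centralizer:
  assumes "x \<in> carrier G"
  shows "subgroup (centralizer G x) G"
proof (rule subgroupI)
  show "centralizer G x \<noteq> {}" using assms by (auto simp: centralizer_def)
  show "inv a \<in> centralizer G x" if "a \<in> centralizer G x" for a
    using that assms by (auto simp: centralizer_def intro: inv_commutes)
  show "a \<otimes> b \<in> centralizer G x" if "a \<in> centralizer G x" "b \<in> centralizer G x" for a b
    using that assms by (auto simp: centralizer_def) (metis m_assoc)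
qed (auto simp: centralizer_def)

lemma AutoGroup_mult:
  "f \<in> Bij (carrier G) \<Longrightarrow> g \<in> Bij (carrier G) \<Longrightarrow>
    f \<otimes>\<^bsub>AutoGroup G\<^esub> g = compose (carrier G) f g"
  by (simp add: AutoGroup_def BijGroup_def)

text \<open>Multiplication in \<open>AutoGroup\<close> is composition restricted to the carrier, so
  off the carrier a group power and an iterate may differ.\<close>

lemma (in group) AutoGroup_pow_apply:
  assumes "f \<in> auto G" and "x \<in> carrier G"
  shows "(f [^]\<^bsub>AutoGroup G\<^esub> m) x = (f ^^ m) x"
  using assms(2)
proof (induction m arbitrary: x)
  case 0
  then show ?case by (simp add: AutoGroup_def BijGroup_def)
next
  case (Suc m)
  interpret A: group "AutoGroup G" by (rule AutoGroup)
  have "f [^]\<^bsub>AutoGroup G\<^esub> m \<in> carrier (AutoGroup G)"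
    using assms(1) by (intro A.nat_pow_closed) (simp add: AutoGroup_def)
  then have pow: "f [^]\<^bsub>AutoGroup G\<^esub> m \<in> Bij (carrier G)"
    by (simp add: AutoGroup_def auto_def)
  have f: "f \<in> Bij (carrier G)" using assms(1) by (simp add: auto_def)
  have "f [^]\<^bsub>AutoGroup G\<^esub> Suc m = compose (carrier G) (f [^]\<^bsub>AutoGroup G\<^esub> m) f"
    by (simp only: A.nat_pow_Suc AutoGroup_mult[OF pow f])
  then have "(f [^]\<^bsub>AutoGroup G\<^esub> Suc m) x = (f [^]\<^bsub>AutoGroup G\<^esub> m) (f x)"
    using Suc.prems by (simp only: compose_eq)
  also have "\<dots> = (f ^^ m) (f x)"
    using Suc.prems f by (intro Suc.IH) (auto dest: Bij_imp_funcset)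
  finally show ?case by (simp only: funpow_Suc_right o_apply)
qed

section \<open>Commutators with \<open>x\<close> as powers of a central element\<close>

text \<open>In the application \<open>d \<otimes> d\<close> generates
  \<open>\<gamma>\<^sub>n(G)\<close>. Its square root \<open>d\<close> is the parameter because the
  construction needs exponents \<open>k * k\<close>, which for \<open>d \<otimes> d\<close> itself
  would have to be halved.\<close>

locale central_commutators = group G for G (structure) +
  fixes p :: nat and x d :: 'a
  assumes fin: "finite (carrier G)"
    and x_closed [simp, intro]: "x \<in> carrier G"
    and d_center: "d \<in> center G"
    and ord_dd: "ord (d \<otimes> d) = p"
    and d_pow: "d [^] p = \<one>"
    and x_pow: "x [^] p = \<one>"
    and commutators: "y \<in> carrier G \<Longrightarrow> \<exists>k::nat. x \<otimes> y = (d \<otimes> d) [^] k \<otimes> (y \<otimes> x)"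
begin

text \<open>The slope is determined only modulo \<open>p\<close>.\<close>

definition slope :: "'a \<Rightarrow> nat \<Rightarrow> bool" where
  "slope y k \<longleftrightarrow> x \<otimes> y = d [^] (2 * k) \<otimes> (y \<otimes> x)"

text \<open>
  With \<open>c = d\<^sup>2\<close>, moving \<open>x\<^sup>i\<close> past an element of slope \<open>j\<close> produces \<open>c\<^sup>i\<^sup>j = d\<^sup>2\<^sup>i\<^sup>j\<close>, which is exactly the
  defect of \<open>d\<^sup>k\<^sup>k\<close> from additivity in \<open>k\<close>.
\<close>

definition twist :: "nat \<Rightarrow> 'a" where
  "twist k = x [^] k \<otimes> d [^] (k * k)"

text \<open>The choice is harmless: slopes of \<open>y\<close> agree modulo \<open>p\<close>, and
  \<open>twist\<close> depends only on the residue. An element \<open>y\<close> of slope 1 goes to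
  \<open>y \<otimes> (x \<otimes> d)\<close>.\<close>

definition alpha :: "'a \<Rightarrow> 'a" where
  "alpha = (\<lambda>y \<in> carrier G. y \<otimes> twist (SOME k. slope y k))"

lemma d_closed [simp, intro]: "d \<in> carrier G"
  using d_center by (simp add: center_def)

lemma d_pow_commute: "y \<in> carrier G \<Longrightarrow> d [^] (k::nat) \<otimes> y = y \<otimes> d [^] k"
  using center_pow[OF d_center] by (simp add: center_def)

lemma d_pow_left_commute:
  "y \<in> carrier G \<Longrightarrow> z \<in> carrier G \<Longrightarrow> d [^] (k::nat) \<otimes> (y \<otimes> z) = y \<otimes> (d [^] k \<otimes> z)"
  using m_assoc[of "d [^] k" y z] m_assoc[of y "d [^] k" z] by (simp add: d_pow_commute[of y])

lemma twist_closed [simp, intro]: "twist k \<in> carrier G"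
  by (simp add: twist_def)

lemma dd_pow: "(d \<otimes> d) [^] (k::nat) = d [^] (2 * k)"
proof -
  have "d \<otimes> d = d [^] (2::nat)" by (simp add: numeral_2_eq_2)
  then show ?thesis by (simp add: nat_pow_pow)
qed

lemma slope_exists: "y \<in> carrier G \<Longrightarrow> \<exists>k. slope y k"
  using commutators by (simp add: slope_def dd_pow)

lemma slope_unique:
  assumes "y \<in> carrier G" "slope y i" "slope y j"
  shows "i mod p = j mod p"
proof -
  have "d [^] (2 * i) = d [^] (2 * j)"
    using assms by (simp add: slope_def)
  then have "(d \<otimes> d) [^] i = (d \<otimes> d) [^] j" by (simp add: dd_pow)
  \<comment> \<open>Integer exponents allow the difference \<open>j - i\<close> without truncation
    at 0.\<close>
  then have "(d \<otimes> d) [^] int i = (d \<otimes> d) [^] int j" by (simp add: int_pow_int)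
  then have "int p dvd int j - int i"
    using int_pow_eq[of "d \<otimes> d" "int i" "int j"] ord_dd by simp
  then show ?thesis
    by (metis mod_eq_dvd_iff zmod_int of_nat_eq_iff)
qed

lemma twist_cong: "i mod p = j mod p \<Longrightarrow> twist i = twist j"
  unfolding twist_def
  using pow_mod_cong[OF x_closed x_pow, of i j]
    pow_mod_cong[OF d_closed d_pow, of "i * i" "j * j"]
  by (metis mod_mult_eq)

lemma alpha_eq:
  assumes "y \<in> carrier G" "slope y k"
  shows "alpha y = y \<otimes> twist k"
proof -
  have "slope y (SOME k. slope y k)" using assms(2) by (rule someI)
  then have "twist (SOME k. slope y k) = twist k"
    using assms slope_unique twist_cong by blast
  then show ?thesis using assms(1) by (simp add: alpha_def)
qed

lemma slope_0: "y \<in> carrier G \<Longrightarrow> slope y 0 \<longleftrightarrow> x \<otimes> y = y \<otimes> x"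
  by (simp add: slope_def)

lemma alpha_fixes: "y \<in> carrier G \<Longrightarrow> x \<otimes> y = y \<otimes> x \<Longrightarrow> alpha y = y"
  using alpha_eq[of y 0] by (simp add: slope_0 twist_def)

text \<open>Moving \<open>x\<close> past \<open>y\<close> and then past \<open>z\<close> leaves one
  central factor each time, and these collect in front. So the slope modulo \<open>p\<close> is a
  homomorphism.\<close>

lemma slope_mult:
  assumes "y \<in> carrier G" "z \<in> carrier G" "slope y i" "slope z j"
  shows "slope (y \<otimes> z) (i + j)"
proof -
  have "x \<otimes> (y \<otimes> z) = d [^] (2 * i) \<otimes> (y \<otimes> (x \<otimes> z))"
  proof -
    have "x \<otimes> (y \<otimes> z) = x \<otimes> y \<otimes> z" using assms by (simp add: m_assoc)
    also have "\<dots> = d [^] (2 * i) \<otimes> (y \<otimes> x) \<otimes> z" using assms by (simp add: slope_def)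
    finally show ?thesis using assms by (simp add: m_assoc)
  qed
  also have "\<dots> = d [^] (2 * i) \<otimes> (y \<otimes> (d [^] (2 * j) \<otimes> (z \<otimes> x)))"
    using assms by (simp add: slope_def)
  also have "\<dots> = d [^] (2 * i) \<otimes> (d [^] (2 * j) \<otimes> (y \<otimes> (z \<otimes> x)))"
    using assms d_pow_left_commute[of y "z \<otimes> x" "2 * j"] by simp
  also have "\<dots> = d [^] (2 * (i + j)) \<otimes> (y \<otimes> z \<otimes> x)"
    using assms by (simp add: m_assoc [symmetric] nat_pow_mult distrib_left)
  finally show ?thesis by (simp add: slope_def)
qed

lemma slope_pow:
  assumes "y \<in> carrier G" "slope y i"
  shows "slope (y [^] (k::nat)) (k * i)"
proof (induction k)
  case 0
  then show ?case by (simp add: slope_def)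
next
  case (Suc k)
  then show ?case
    using slope_mult[of "y [^] k" y "k * i" i] assms by (simp add: add.commute)
qed

text \<open>The power \<open>d [^] (2 * k)\<close> is \<open>(d \<otimes> d) [^] k\<close>, and
  \<open>d \<otimes> d\<close> has order \<open>p\<close>. Thus the centralizer of \<open>x\<close>
  is the kernel of the slope modulo \<open>p\<close>.\<close>

lemma commute_iff_slope:
  assumes "y \<in> carrier G" "slope y k"
  shows "x \<otimes> y = y \<otimes> x \<longleftrightarrow> p dvd k"
proof -
  have "x \<otimes> y = y \<otimes> x \<longleftrightarrow> d [^] (2 * k) = \<one>"
    using assms by (simp add: slope_def)
  then show ?thesis
    using pow_eq_id[of "d \<otimes> d" k] by (simp add: dd_pow ord_dd)
qed

section \<open>Maximality of the centralizer of \<open>x\<close>\<close>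

text \<open>An \<open>h\<close> outside the centralizer has slope invertible modulo
  \<open>p\<close>, so a suitable power of \<open>h\<close> carries any \<open>y\<close> into the
  centralizer. Hence \<open>h\<close> and the centralizer together generate
  \<open>G\<close>.\<close>

lemma maximal_subgroup_centralizer:
  assumes "Factorial_Ring.prime p" and "x \<notin> center G"
  shows "maximal_subgroup (centralizer G x) G"
  unfolding maximal_subgroup_def
proof (intro conjI allI impI)
  show "subgroup (centralizer G x) G" by (simp add: subgroup_centralizer)
  show "centralizer G x \<noteq> carrier G"
  proof
    assume "centralizer G x = carrier G"
    then have "g \<otimes> x = x \<otimes> g" if "g \<in> carrier G" for g
      using that unfolding centralizer_def by blast
    then show False using assms(2) by (simp add: center_def)
  qed
  fix H assume H: "subgroup H G" and sub: "centralizer G x \<subseteq> H"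
  show "H = centralizer G x \<or> H = carrier G"
  proof (cases "H = centralizer G x")
    case False
    then obtain h where hH: "h \<in> H" and hC: "h \<notin> centralizer G x" using sub by blast
    have h: "h \<in> carrier G" using hH H subgroup.mem_carrier by fastforce
    then obtain i where i: "slope h i" using slope_exists by blast
    have "x \<otimes> h \<noteq> h \<otimes> x" using hC h by (auto simp: centralizer_def)
    then have ndvd: "\<not> p dvd i" using commute_iff_slope[OF h i] by simp
    then have "i \<noteq> 0" by (metis dvd_0_right)
    \<comment> \<open>Here \<open>e\<close> is a common divisor of \<open>i\<close> and the prime
      \<open>p\<close>; it is 1 as \<open>p\<close> does not divide \<open>i\<close>. So
      \<open>a\<close> inverts \<open>i\<close> modulo \<open>p\<close>.\<close>
    then obtain e a b where e: "e dvd i" "e dvd p" and ab: "i * a = p * b + e"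
      using bezout_add_strong_nat[of i p] by blast
    have "e = 1" using e ndvd assms(1) unfolding prime_nat_iff by blast
    have "y \<in> H" if y: "y \<in> carrier G" for y
    proof -
      obtain j where j: "slope y j" using y slope_exists by blast
      \<comment> \<open>The factor \<open>p - 1\<close> plays the role of -1 in the natural numbers:
        \<open>k * i\<close> is congruent to \<open>-j\<close>, so
        \<open>h [^] k \<otimes> y\<close> has slope 0 modulo \<open>p\<close>.\<close>
      define k where "k = a * (p - 1) * j"
      have "slope (h [^] k \<otimes> y) (k * i + j)"
        using slope_mult slope_pow h i y j by simp
      moreover have "p dvd k * i + j"
      proof -
        have "p > 0" using assms(1) prime_gt_0_nat by blast
        have "k * i + j = (i * a) * ((p - 1) * j) + j" by (simp add: k_def)
        also have "\<dots> = p * (b * ((p - 1) * j)) + (p - 1 + 1) * j"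
          unfolding ab \<open>e = 1\<close> by (simp only: distrib_right mult_1 mult.assoc)
        also have "\<dots> = p * (b * ((p - 1) * j) + j)"
          using \<open>p > 0\<close> by (simp add: distrib_left)
        finally show ?thesis by simp
      qed
      ultimately have "x \<otimes> (h [^] k \<otimes> y) = h [^] k \<otimes> y \<otimes> x"
        using commute_iff_slope[of "h [^] k \<otimes> y" "k * i + j"] h y by blast
      then have "h [^] k \<otimes> y \<in> centralizer G x"
        using h y by (simp add: centralizer_def)
      then have "h [^] k \<otimes> y \<in> H" using sub by blast
      moreover have "inv (h [^] k) \<in> H"
      proof -
        have "h [^] k \<in> H"
          by (induction k) (use H hH in \<open>auto intro: subgroup.m_closed subgroup.one_closed\<close>)
        then show ?thesis using H by (simp add: subgroup.m_inv_closed)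
      qed
      ultimately have "inv (h [^] k) \<otimes> (h [^] k \<otimes> y) \<in> H"
        using H by (simp add: subgroup.m_closed)
      then show ?thesis using h y by (simp add: m_assoc [symmetric])
    qed
    then have "H = carrier G" using H subgroup.subset by blast
    then show ?thesis ..
  qed simp
qed

section \<open>The automorphism \<open>alpha\<close>: multiplicativity, order and
  non-innerness\<close>

lemma x_pow_slope:
  assumes "z \<in> carrier G" "slope z j"
  shows "x [^] k \<otimes> z = d [^] (2 * k * j) \<otimes> (z \<otimes> x [^] (k::nat))"
proof (induction k)
  case 0
  then show ?case using assms by simp
next
  case (Suc k)
  have "x [^] Suc k \<otimes> z = x [^] k \<otimes> (d [^] (2 * j) \<otimes> (z \<otimes> x))"
    using assms by (simp add: slope_def m_assoc)
  also have "\<dots> = d [^] (2 * j) \<otimes> (x [^] k \<otimes> z \<otimes> x)"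
    using assms d_pow_left_commute[of "x [^] k" "z \<otimes> x" "2 * j"] by (simp add: m_assoc)
  also have "\<dots> = d [^] (2 * j) \<otimes> (d [^] (2 * k * j) \<otimes> (z \<otimes> x [^] k) \<otimes> x)"
    by (simp only: Suc)
  also have "\<dots> = d [^] (2 * j + 2 * k * j) \<otimes> (z \<otimes> x [^] Suc k)"
    using assms by (simp add: m_assoc nat_pow_mult [symmetric])
  finally show ?case by (simp add: algebra_simps)
qed

text \<open>This is multiplicativity of \<open>alpha\<close> with the left factor \<open>y\<close>
  cancelled. Moving \<open>x [^] i\<close> past \<open>z\<close> adds \<open>2 * i * j\<close> to
  the exponent of \<open>d\<close>, which completes \<open>i * i + j * j\<close> to a
  square.\<close>

lemma twist_slope:
  assumes "z \<in> carrier G" "slope z j"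
  shows "twist i \<otimes> z \<otimes> twist j = z \<otimes> twist (i + j)"
proof -
  have "twist i = d [^] (i * i) \<otimes> x [^] i" "twist j = d [^] (j * j) \<otimes> x [^] j"
    by (simp_all add: twist_def d_pow_commute)
  then have "twist i \<otimes> z \<otimes> twist j
      = d [^] (i * i) \<otimes> (x [^] i \<otimes> z) \<otimes> (d [^] (j * j) \<otimes> x [^] j)"
    using assms by (simp add: m_assoc)
  also have "\<dots> = d [^] (i * i) \<otimes> (d [^] (2 * i * j) \<otimes> (z \<otimes> x [^] i)) \<otimes> (d [^] (j * j) \<otimes> x [^] j)"
    by (simp only: x_pow_slope[OF assms])
  also have "\<dots> = d [^] (i * i) \<otimes> (d [^] (2 * i * j) \<otimes> (d [^] (j * j) \<otimes> (z \<otimes> (x [^] i \<otimes> x [^] j))))"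
    using assms d_pow_left_commute[of "z \<otimes> x [^] i" "x [^] j" "j * j"] by (simp add: m_assoc)
  also have "\<dots> = d [^] (i * i + (2 * i * j + j * j)) \<otimes> (z \<otimes> x [^] (i + j))"
    using assms by (simp add: m_assoc nat_pow_mult [symmetric])
  also have "i * i + (2 * i * j + j * j) = (i + j) * (i + j)"
    by (simp add: algebra_simps)
  also have "d [^] ((i + j) * (i + j)) \<otimes> (z \<otimes> x [^] (i + j)) = z \<otimes> twist (i + j)"
    using assms d_pow_left_commute[of z "x [^] (i + j)"] d_pow_commute[of "x [^] (i + j)"]
    by (simp add: twist_def)
  finally show ?thesis .
qed

lemma alpha_closed: "y \<in> carrier G \<Longrightarrow> alpha y \<in> carrier G"
  using slope_exists alpha_eq by fastforce

lemma alpha_mult: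
  assumes "y \<in> carrier G" "z \<in> carrier G"
  shows "alpha (y \<otimes> z) = alpha y \<otimes> alpha z"
proof -
  obtain i j where ij: "slope y i" "slope z j"
    using assms slope_exists by blast
  have "alpha (y \<otimes> z) = y \<otimes> (z \<otimes> twist (i + j))"
    using assms alpha_eq[OF _ slope_mult[OF assms ij]] by (simp add: m_assoc)
  also have "\<dots> = y \<otimes> (twist i \<otimes> z \<otimes> twist j)"
    using assms ij twist_slope by simp
  also have "\<dots> = alpha y \<otimes> alpha z"
    using assms alpha_eq[OF assms(1) ij(1)] alpha_eq[OF assms(2) ij(2)] by (simp add: m_assoc)
  finally show ?thesis .
qed

text \<open>Hence \<open>alpha\<close> fixes every twist, which both the injectivity of
  \<open>alpha\<close> and the formula for its iterates rest on.\<close>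

lemma x_commutes_twist: "x \<otimes> twist k = twist k \<otimes> x"
proof -
  have "x [^] k \<otimes> x = x \<otimes> x [^] k"
    using nat_pow_Suc2[of x k] by simp
  then have "x \<otimes> twist k = x [^] k \<otimes> x \<otimes> d [^] (k * k)"
    by (simp add: twist_def m_assoc [symmetric])
  also have "\<dots> = x [^] k \<otimes> (d [^] (k * k) \<otimes> x)"
    by (simp add: d_pow_commute[of x] m_assoc)
  finally show ?thesis by (simp add: twist_def m_assoc)
qed

lemma alpha_hom: "alpha \<in> hom G G"
  by (simp add: hom_def alpha_mult alpha_closed)

text \<open>A kernel element is the inverse of a twist, so it commutes with \<open>x\<close> and is
  fixed by \<open>alpha\<close>; thus it is \<open>\<one>\<close>. Finiteness turns injectivity into
  bijectivity.\<close>

lemma alpha_auto: "alpha \<in> auto G"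
proof -
  have hom: "group_hom G G alpha"
    using alpha_hom by (simp add: group_hom_def group_hom_axioms_def is_group)
  have "y = \<one>" if y: "y \<in> carrier G" and one: "alpha y = \<one>" for y
  proof -
    obtain k where k: "slope y k" using slope_exists[OF y] by blast
    then have "y \<otimes> twist k = \<one>"
      using one alpha_eq[OF y k] by simp
    then have "inv (twist k) = y"
      by (rule inv_equality) (use y in simp_all)
    then have "x \<otimes> y = y \<otimes> x"
      using inv_commutes[of "twist k" x] x_commutes_twist[of k] by simp
    then show ?thesis
      using one alpha_fixes[OF y] by simp
  qed
  then have "inj_on alpha (carrier G)"
    unfolding group_hom.inj_iff_trivial_ker[OF hom] kernel_def
    using alpha_fixes[OF one_closed] by auto
  moreover have "alpha ` carrier G \<subseteq> carrier G"
    using alpha_closed by blast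
  ultimately have "bij_betw alpha (carrier G) (carrier G)"
    using endo_inj_surj[OF fin] by (simp add: bij_betw_def)
  then show ?thesis
    using alpha_hom by (simp add: auto_def Bij_def alpha_def)
qed

lemma twist_pow: "twist k [^] p = \<one>"
proof -
  have "twist k [^] p = (x [^] k) [^] p \<otimes> (d [^] (k * k)) [^] p"
    unfolding twist_def by (rule pow_mult_distrib) (simp_all add: d_pow_commute)
  also have "\<dots> = (x [^] p) [^] k \<otimes> (d [^] p) [^] (k * k)"
    by (simp add: nat_pow_pow mult.commute)
  finally show ?thesis by (simp add: x_pow d_pow)
qed

text \<open>Since \<open>alpha\<close> fixes the powers of \<open>twist k\<close>, each further
  application only contributes one more factor \<open>twist k\<close>.\<close>

lemma funpow_alpha:
  assumes y: "y \<in> carrier G" and k: "slope y k"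
  shows "(alpha ^^ m) y = y \<otimes> twist k [^] m"
proof (induction m)
  case 0
  show ?case using y by simp
next
  case (Suc m)
  have "twist k [^] m \<otimes> x = x \<otimes> twist k [^] m"
    using x_commutes_twist[symmetric] by (rule group_commutes_pow) simp_all
  then have "alpha (twist k [^] m) = twist k [^] m"
    by (intro alpha_fixes) simp_all
  then have "alpha (y \<otimes> twist k [^] m) = y \<otimes> twist k \<otimes> twist k [^] m"
    using alpha_mult[OF y, of "twist k [^] m"] alpha_eq[OF y k] by simp
  also have "\<dots> = y \<otimes> twist k [^] Suc m"
    using y by (simp only: m_assoc twist_closed nat_pow_closed nat_pow_Suc2)
  finally show ?case by (simp only: funpow.simps o_apply Suc)
qed

lemma alpha_pow_p: "alpha [^]\<^bsub>AutoGroup G\<^esub> p = \<one>\<^bsub>AutoGroup G\<^esub>"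
proof -
  interpret A: group "AutoGroup G" by (rule AutoGroup)
  have "alpha [^]\<^bsub>AutoGroup G\<^esub> p \<in> carrier (AutoGroup G)"
    using alpha_auto by (intro A.nat_pow_closed) (simp add: AutoGroup_def)
  \<comment> \<open>Extensionality reduces the equality of maps to equality on the carrier.\<close>
  then have "alpha [^]\<^bsub>AutoGroup G\<^esub> p \<in> extensional (carrier G)"
    by (simp add: AutoGroup_def auto_def Bij_def)
  moreover have "(alpha [^]\<^bsub>AutoGroup G\<^esub> p) y = y" if y: "y \<in> carrier G" for y
  proof -
    from slope_exists[OF y] obtain k where "slope y k" ..
    then show ?thesis
      using y by (simp add: AutoGroup_pow_apply[OF alpha_auto] funpow_alpha twist_pow)
  qed
  ultimately show ?thesis
    by (intro extensionalityI[of _ "carrier G"]) (simp_all add: AutoGroup_def BijGroup_def)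
qed

text \<open>The identity is conjugation by \<open>\<one>\<close>, so a non-inner
  \<open>alpha\<close> cannot have order 1.\<close>

lemma ord_alpha:
  assumes "Factorial_Ring.prime p" and "alpha \<notin> inner_auto G"
  shows "group.ord (AutoGroup G) alpha = p"
proof -
  interpret A: group "AutoGroup G" by (rule AutoGroup)
  have alpha: "alpha \<in> carrier (AutoGroup G)"
    using alpha_auto by (simp add: AutoGroup_def)
  have "\<one>\<^bsub>AutoGroup G\<^esub> \<in> inner_auto G"
    unfolding inner_auto_def
    by (rule image_eqI[of _ _ \<one>]) (auto simp: AutoGroup_def BijGroup_def)
  then have "A.ord alpha \<noteq> 1"
    using A.ord_eq_1[OF alpha] assms(2) by metis
  moreover have "A.ord alpha dvd p"
    using A.pow_eq_id[OF alpha] alpha_pow_p by blast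
  ultimately show ?thesis
    using assms(1) by (auto simp: prime_nat_iff)
qed

text \<open>Conjugation by \<open>h\<close> and the definition of \<open>alpha\<close> give two
  values at \<open>g\<close>; comparing them identifies the commutator of \<open>h\<close> and
  \<open>g\<close> with \<open>x \<otimes> d\<close>. By \<open>ZC\<close> it is central, and then
  so is \<open>x\<close>.\<close>

lemma alpha_not_inner:
  assumes x: "x \<notin> center G"
    and g: "g \<in> carrier G" "slope g 1"
    and ZC: "\<And>h y. h \<in> center (G\<lparr>carrier := centralizer G x\<rparr>) \<Longrightarrow> y \<in> carrier G \<Longrightarrow>
      h \<otimes> y \<otimes> inv h \<otimes> inv y \<in> center G"
  shows "alpha \<notin> inner_auto G"
proof
  assume "alpha \<in> inner_auto G"
  then obtain h where h: "h \<in> carrier G" and "alpha = (\<lambda>y \<in> carrier G. h \<otimes> y \<otimes> inv h)"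
    by (auto simp: inner_auto_def)
  then have conj: "alpha y = h \<otimes> y \<otimes> inv h" if "y \<in> carrier G" for y
    using that by simp
  have hC: "h \<otimes> y = y \<otimes> h" if "y \<in> centralizer G x" for y
  proof -
    have y: "y \<in> carrier G" "x \<otimes> y = y \<otimes> x" using that by (auto simp: centralizer_def)
    then have "h \<otimes> y \<otimes> inv h = y" using alpha_fixes conj by metis
    then show ?thesis using y(1) h by (metis inv_solve_right m_closed)
  qed
  \<comment> \<open>As \<open>x\<close> lies in its own centralizer, \<open>h\<close> commutes with
    it.\<close>
  have "h \<in> centralizer G x"
    using hC[of x] h by (simp add: centralizer_def)
  then have "h \<in> center (G\<lparr>carrier := centralizer G x\<rparr>)"
    using hC by (simp add: center_def)
  then have z: "h \<otimes> g \<otimes> inv h \<otimes> inv g \<in> center G" (is "?z \<in> _")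
    using ZC g(1) by blast
  have "?z \<otimes> g = g \<otimes> twist 1"
    using conj[OF g(1)] alpha_eq[OF g] g(1) h by (simp add: m_assoc)
  moreover have "?z \<otimes> g = g \<otimes> ?z"
    using z g(1) by (simp add: center_def)
  ultimately have "twist 1 = ?z"
    using g(1) h by simp
  then have tw: "x \<otimes> d \<in> center G" using z by (simp add: twist_def)
  have "x \<otimes> y = y \<otimes> x" if y: "y \<in> carrier G" for y
  proof -
    have "x \<otimes> y \<otimes> d = x \<otimes> d \<otimes> y"
      using y d_center by (simp add: center_def m_assoc)
    also have "\<dots> = y \<otimes> x \<otimes> d"
      using tw y by (simp add: center_def m_assoc)
    finally have "x \<otimes> y \<otimes> d = y \<otimes> x \<otimes> d" .
    then show ?thesis using y by simp
  qed
  then show False using x by (simp add: center_def)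
qed

end

section \<open>Commutator subgroups, the lower central series and the exponent\<close>

lemma (in group) commutator_in_commutator_subgroup:
  "h \<in> H \<Longrightarrow> k \<in> K \<Longrightarrow> h \<otimes> k \<otimes> inv h \<otimes> inv k \<in> commutator_subgroup G H K"
  unfolding commutator_subgroup_def by (rule generate.incl) blast

lemma (in group) subgroup_commutator_subgroup:
  "H \<subseteq> carrier G \<Longrightarrow> K \<subseteq> carrier G \<Longrightarrow> subgroup (commutator_subgroup G H K) G"
  unfolding commutator_subgroup_def by (rule generate_is_subgroup) (auto simp: subset_iff)

lemma (in group) subgroup_lower_central: "subgroup (lower_central G m) G"
proof (induction m)
  case (Suc m)
  then show ?case
    by (cases m) (simp_all add: subgroup_self subgroup_commutator_subgroup subgroup.subset)
qed (simp add: subgroup_self)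

lemma (in group) commutator_mult:
  assumes "x \<in> carrier G" "y \<in> carrier G"
  shows "x \<otimes> y \<otimes> inv x \<otimes> inv y \<otimes> (y \<otimes> x) = x \<otimes> y"
proof -
  have "inv x \<otimes> inv y \<otimes> (y \<otimes> x) = \<one>"
    using assms by (simp flip: inv_mult_group)
  then show ?thesis using assms m_assoc[of "x \<otimes> y" "inv x \<otimes> inv y" "y \<otimes> x"]
    by (simp add: m_assoc)
qed

lemma (in group) commutator_one_iff:
  assumes "x \<in> carrier G" "y \<in> carrier G"
  shows "x \<otimes> y \<otimes> inv x \<otimes> inv y = \<one> \<longleftrightarrow> x \<otimes> y = y \<otimes> x"
proof -
  have "x \<otimes> y = y \<otimes> x \<longleftrightarrow> x \<otimes> y \<otimes> inv x \<otimes> inv y \<otimes> (y \<otimes> x) = y \<otimes> x"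
    by (simp only: commutator_mult[OF assms])
  then show ?thesis
    using r_cancel_one[of "y \<otimes> x" "x \<otimes> y \<otimes> inv x \<otimes> inv y"] assms by simp
qed

text \<open>Applied to \<open>\<gamma>\<^sub>n(G)\<close> it gives centrality; applied to
  \<open>\<gamma>\<^sub>n\<^sub>-\<^sub>1(G)\<close> it gives a non-central element.\<close>

lemma (in group) commutator_subgroup_trivial_iff:
  assumes "H \<subseteq> carrier G"
  shows "commutator_subgroup G H (carrier G) = {\<one>} \<longleftrightarrow> H \<subseteq> center G"
proof
  assume trivial: "commutator_subgroup G H (carrier G) = {\<one>}"
  show "H \<subseteq> center G"
  proof
    fix h assume h: "h \<in> H"
    have "h \<otimes> g = g \<otimes> h" if g: "g \<in> carrier G" for g
    proof -
      have "h \<otimes> g \<otimes> inv h \<otimes> inv g = \<one>"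
        using commutator_in_commutator_subgroup[OF h g] trivial by blast
      then show ?thesis
        using commutator_one_iff[of h g] h g assms by blast
    qed
    then show "h \<in> center G" using h assms by (auto simp: center_def)
  qed
next
  assume "H \<subseteq> center G"
  then have "h \<otimes> g \<otimes> inv h \<otimes> inv g = \<one>" if "h \<in> H" "g \<in> carrier G" for h g
    using that assms commutator_one_iff[of h g] by (auto simp: center_def)
  then have "commutator_subgroup G H (carrier G) \<subseteq> generate G {\<one>}"
    unfolding commutator_subgroup_def by (intro mono_generate) auto
  moreover have "\<one> \<in> commutator_subgroup G H (carrier G)"
    unfolding commutator_subgroup_def by (rule generate.one)
  ultimately show "commutator_subgroup G H (carrier G) = {\<one>}"
    using generate_one by auto
qed

text \<open>The \<open>LEAST\<close> is meaningful only if some positive exponent works; by Lagrange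
  the order of \<open>G\<close> does.\<close>

lemma (in group) pow_group_exponent:
  assumes "finite (carrier G)" "subgroup H G" "x \<in> H"
  shows "x [^] group_exponent (G\<lparr>carrier := H\<rparr>) = \<one>"
proof -
  define P where "P m \<longleftrightarrow> m > 0 \<and> (\<forall>x \<in> H. x [^] m = \<one>)" for m :: nat
  have "P (order G)"
    unfolding P_def
  proof (intro conjI ballI)
    show "order G > 0" using assms(1) order_gt_0_iff_finite by blast
    show "y [^] order G = \<one>" if "y \<in> H" for y
      by (rule pow_order_eq_1) (rule subgroup.mem_carrier[OF assms(2) that])
  qed
  then have "P (LEAST m. P m)" by (rule LeastI)
  moreover have "group_exponent (G\<lparr>carrier := H\<rparr>) = (LEAST m. P m)"
    by (simp add: group_exponent_def P_def flip: nat_pow_consistent)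
  ultimately show ?thesis
    using assms(3) by (simp add: P_def)
qed

theorem theorem2p1:
  fixes G :: "('a, 'b) monoid_scheme" and p n :: nat
  assumes "Factorial_Ring.prime p" and "p > 2"
    and "group G" and "finite (carrier G)" and "p_group p G"
    and "n \<ge> 4" and "has_nilpotency_class G n"
    and "card (lower_central G n) = p"
    and "group_exponent (G\<lparr>carrier := lower_central G (n - 1)\<rparr>) = p"
    and "\<forall>x \<in> lower_central G (n - 1) - center G.
           center (G\<lparr>carrier := centralizer G x\<rparr>) \<subseteq> lower_central G (n - 1)"
  shows "\<exists>\<alpha> \<in> auto G. \<alpha> \<notin> inner_auto G \<and> group.ord (AutoGroup G) \<alpha> = p \<and>
           (\<forall>u \<in> frattini G. \<alpha> u = u)"
proof -
  interpret group G by fact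
  define Z where "Z = lower_central G n"
  define K where "K = lower_central G (n - 1)"
  \<comment> \<open>The commutator clause of \<open>lower_central\<close> applies only to a double
    successor.\<close>
  obtain m where m: "n = Suc (Suc m)"
    using \<open>n \<ge> 4\<close> that[of "n - 2"] by simp
  have Z_eq: "Z = commutator_subgroup G K (carrier G)"
    by (simp add: Z_def K_def m)
  have subZ: "subgroup Z G" and subK: "subgroup K G"
    by (simp_all add: Z_def K_def subgroup_lower_central)
  have "commutator_subgroup G Z (carrier G) = {\<one>\<^bsub>G\<^esub>}" and Z_nontriv: "Z \<noteq> {\<one>\<^bsub>G\<^esub>}"
    using \<open>has_nilpotency_class G n\<close> by (simp_all add: has_nilpotency_class_def Z_def m)
  then have Z_central: "Z \<subseteq> center G"
    using commutator_subgroup_trivial_iff subZ subgroup.subset by blast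
  have K_comm: "h \<otimes>\<^bsub>G\<^esub> y \<otimes>\<^bsub>G\<^esub> inv\<^bsub>G\<^esub> h \<otimes>\<^bsub>G\<^esub> inv\<^bsub>G\<^esub> y \<in> Z"
    if "h \<in> K" "y \<in> carrier G" for h y
    using that commutator_in_commutator_subgroup by (simp add: Z_eq)
  obtain x where xK: "x \<in> K" and x_noncentral: "x \<notin> center G"
    using commutator_subgroup_trivial_iff[of K] subK Z_nontriv Z_eq subgroup.subset by blast
  have x: "x \<in> carrier G" using xK subK subgroup.mem_carrier by fastforce
  then obtain g where g: "g \<in> carrier G" "x \<otimes>\<^bsub>G\<^esub> g \<noteq> g \<otimes>\<^bsub>G\<^esub> x"
    using x_noncentral by (auto simp: center_def)
  \<comment> \<open>Taking this very commutator as the generator of \<open>Z\<close> gives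
    \<open>g\<close> slope 1.\<close>
  define c where "c = x \<otimes>\<^bsub>G\<^esub> g \<otimes>\<^bsub>G\<^esub> inv\<^bsub>G\<^esub> x \<otimes>\<^bsub>G\<^esub> inv\<^bsub>G\<^esub> g"
  have c: "c \<in> Z" "c \<noteq> \<one>\<^bsub>G\<^esub>"
    using K_comm xK g x commutator_one_iff by (auto simp: c_def)
  then have c_center: "c \<in> center G" using Z_central by blast
  then have c_carrier: "c \<in> carrier G" by (simp add: center_def)
  have cardZ: "card Z = p" using assms(8) by (simp add: Z_def)
  note gen = prime_card_subgroup_generator[OF subZ cardZ assms(1) c assms(4)]
  have c_pow: "c [^]\<^bsub>G\<^esub> p = \<one>\<^bsub>G\<^esub>" using gen(1) c_carrier pow_ord_eq_1 by metis
  \<comment> \<open>As \<open>p\<close> is odd, \<open>c\<close> has a square root among its powers.\<close>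
  define d where "d = c [^]\<^bsub>G\<^esub> ((p + 1) div 2)"
  have "odd p" using assms(1,2) prime_odd_nat by simp
  then have "(p + 1) div 2 + (p + 1) div 2 = p + 1" by presburger
  then have "d \<otimes>\<^bsub>G\<^esub> d = c [^]\<^bsub>G\<^esub> (p + 1)"
    using nat_pow_mult[OF c_carrier, of "(p + 1) div 2" "(p + 1) div 2"] unfolding d_def by simp
  then have dd: "d \<otimes>\<^bsub>G\<^esub> d = c" using c_carrier c_pow by simp
  interpret central_commutators G p x d
  proof
    show "d \<in> center G" unfolding d_def using c_center by (rule center_pow)
    show "ord (d \<otimes>\<^bsub>G\<^esub> d) = p" using dd gen(1) by simp
    show "d [^]\<^bsub>G\<^esub> p = \<one>\<^bsub>G\<^esub>"
      using c_carrier c_pow unfolding d_def by (metis mult.commute nat_pow_one nat_pow_pow)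
    show "x [^]\<^bsub>G\<^esub> p = \<one>\<^bsub>G\<^esub>"
      using pow_group_exponent[OF assms(4) subK xK] assms(9) by (simp add: K_def)
    fix y assume y: "y \<in> carrier G"
    obtain k :: nat where "x \<otimes>\<^bsub>G\<^esub> y \<otimes>\<^bsub>G\<^esub> inv\<^bsub>G\<^esub> x \<otimes>\<^bsub>G\<^esub> inv\<^bsub>G\<^esub> y = c [^]\<^bsub>G\<^esub> k"
      using gen(2) K_comm[OF xK y] by blast
    then have "x \<otimes>\<^bsub>G\<^esub> y = c [^]\<^bsub>G\<^esub> k \<otimes>\<^bsub>G\<^esub> (y \<otimes>\<^bsub>G\<^esub> x)"
      using commutator_mult[OF x y] by simp
    then show "\<exists>k::nat. x \<otimes>\<^bsub>G\<^esub> y = (d \<otimes>\<^bsub>G\<^esub> d) [^]\<^bsub>G\<^esub> k \<otimes>\<^bsub>G\<^esub> (y \<otimes>\<^bsub>G\<^esub> x)"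
      using dd by auto
  qed (use assms(4) x in auto)
  have "slope g 1"
    using commutator_mult[OF x g(1)] dd_pow[of 1] dd c_carrier by (simp add: slope_def c_def)
  moreover have "center (G\<lparr>carrier := centralizer G x\<rparr>) \<subseteq> K"
    using assms(10) xK x_noncentral by (simp add: K_def)
  \<comment> \<open>The hypothesis \<open>ZC\<close> holds because the centre of the centralizer
    lies in \<open>K\<close>, and commutators of elements of \<open>K\<close> lie in the central
    subgroup \<open>Z\<close>.\<close>
  ultimately have outer: "alpha \<notin> inner_auto G"
    using alpha_not_inner[OF x_noncentral g(1)] K_comm Z_central by blast
  have "maximal_subgroup (centralizer G x) G"
    using assms(1) x_noncentral by (rule maximal_subgroup_centralizer)
  then have "frattini G \<subseteq> centralizer G x"
    by (auto simp: frattini_def)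
  then have "\<forall>u \<in> frattini G. alpha u = u"
    using alpha_fixes by (auto simp: centralizer_def)
  then show ?thesis
    using alpha_auto outer ord_alpha[OF assms(1) outer] by blast
qed

end
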